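(* Let $X$ be a Hilbert space, $\alpha \in (0,1)$ and $R:X \to X$ be $\alpha$-averaged. Then $R$ is super strongly nonexpansive with modulus $\chi(\varepsilon):=\varepsilon^2 \cdot \frac{1-\alpha}{\alpha}$.
   Context: A mapping $T:X\to X$ is nonexpansive if $\|Tx-Ty\|\le\|x-y\|$ for all $x,y\in X$. For $\alpha\in(0,1)$, a mapping $R:X\to X$ is $\alpha$-averaged if there is a nonexpansive mapping $T:X\to X$ such that $R=(1-\alpha)\mathrm{id}_X+\alpha T$. $R$ is super strongly nonexpansive with modulus $\chi:(0,\infty)\to(0,\infty)$ if $\chi$ is an SSNE-modulus for $R$: for any $\varepsilon>0$ and $x,y\in X$ with $\|x-y\|^2-\|Rx-Ry\|^2<\chi(\varepsilon)$, we have $\|(x-y)-(Rx-Ry)\|<\varepsilon$. (Existence of such a $\chi$ is equivalent to $R$ being super strongly nonexpansive: $R$ is nonexpansive and, whenever $(x_n),(y_n)\subseteq X$ with $\|x_n-y_n\|^2-\|Rx_n-Ry_n\|^2\to0$, then $(x_n-y_n)-(Rx_n-Ry_n)\to0$.) *)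

theory Defs
  imports "HOL-Analysis.Analysis"
begin

definition nonexpansive :: "('a::real_normed_vector \<Rightarrow> 'a) \<Rightarrow> bool" where
  "nonexpansive T \<longleftrightarrow> (\<forall>x y. norm (T x - T y) \<le> norm (x - y))"

(* Only meaningful for 0 < \<alpha> < 1; that range is a hypothesis where the notion is used. *)
definition averaged :: "real \<Rightarrow> ('a::real_normed_vector \<Rightarrow> 'a) \<Rightarrow> bool" where
  "averaged \<alpha> R \<longleftrightarrow>
     (\<exists>T. nonexpansive T \<and> R = (\<lambda>x. (1 - \<alpha>) *\<^sub>R x + \<alpha> *\<^sub>R T x))"

(* A modulus is a function from (0, \<infinity>) to (0, \<infinity>): positivity on positive arguments
   is part of the notion, and values at non-positive arguments are irrelevant. *)
definition super_strongly_nonexpansive_with_modulus ::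
    "('a::real_normed_vector \<Rightarrow> 'a) \<Rightarrow> (real \<Rightarrow> real) \<Rightarrow> bool" where
  "super_strongly_nonexpansive_with_modulus R \<omega> \<longleftrightarrow>
     (\<forall>\<epsilon>>0. \<omega> \<epsilon> > 0) \<and>
     (\<forall>\<epsilon>>0. \<forall>x y. (norm (x - y))\<^sup>2 - (norm (R x - R y))\<^sup>2 < \<omega> \<epsilon>
        \<longrightarrow> norm ((x - y) - (R x - R y)) < \<epsilon>)"

end

theory Submission
  imports Defs
begin

text \<open>Averagedness makes \<open>R x - R y\<close> a convex combination of
  \<open>u = x - y\<close> and \<open>v = T x - T y\<close>, where
  \<open>norm v \<le> norm u\<close>. In an inner product space the squared norm of such a
  combination falls short of the convex combination of squared norms by exactly
  \<open>\<alpha> * (1 - \<alpha>) * (norm (u - v))\<^sup>2\<close>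
  (\<open>norm_convex_combination_squared\<close>). As \<open>u - (R x - R y)\<close> is
  \<open>\<alpha>\<close> times \<open>u - v\<close>, this deficit bounds the displacement by the
  gap of squared norms.\<close>

lemma norm_convex_combination_squared:
  fixes u v :: "'a::real_inner"
  shows "(norm ((1 - t) *\<^sub>R u + t *\<^sub>R v))\<^sup>2 =
    (1 - t) * (norm u)\<^sup>2 + t * (norm v)\<^sup>2 - t * (1 - t) * (norm (u - v))\<^sup>2"
  unfolding power2_norm_eq_inner
  by (simp add: inner_add_left inner_add_right inner_diff_left inner_diff_right
      inner_commute[of v u] algebra_simps)

text \<open>The modulus is read off from this estimate: a gap below \<epsilon>^2 times the factor on
  the left forces a displacement below \<epsilon>.\<close>

lemma averaged_norm_diff_squared:
  fixes R :: "'a::real_inner \<Rightarrow> 'a"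
  assumes "0 < \<alpha>" and "averaged \<alpha> R"
  shows "(1 - \<alpha>) / \<alpha> * (norm ((x - y) - (R x - R y)))\<^sup>2
    \<le> (norm (x - y))\<^sup>2 - (norm (R x - R y))\<^sup>2"
proof -
  obtain T where T: "norm (T x - T y) \<le> norm (x - y)"
    and R: "R = (\<lambda>x. (1 - \<alpha>) *\<^sub>R x + \<alpha> *\<^sub>R T x)"
    using assms(2) unfolding averaged_def nonexpansive_def by blast
  define u v where "u = x - y" and "v = T x - T y"
  have Ruv: "R x - R y = (1 - \<alpha>) *\<^sub>R u + \<alpha> *\<^sub>R v"
    by (simp add: R u_def v_def algebra_simps)
  have "u - (R x - R y) = \<alpha> *\<^sub>R (u - v)"
    by (simp add: Ruv algebra_simps)
  \<comment> \<open>The norm contributes \<open>\<alpha>\<^sup>2\<close>, and the denominator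
    cancels one factor.\<close>
  then have "(1 - \<alpha>) / \<alpha> * (norm (u - (R x - R y)))\<^sup>2 = \<alpha> * (1 - \<alpha>) * (norm (u - v))\<^sup>2"
    using assms(1) by (simp add: power_mult_distrib power2_eq_square)
  moreover have "\<alpha> * (norm v)\<^sup>2 \<le> \<alpha> * (norm u)\<^sup>2"
    using T assms(1) by (simp add: u_def v_def power_mono)
  \<comment> \<open>By the identity, the gap equals
    \<open>\<alpha> * ((norm u)\<^sup>2 - (norm v)\<^sup>2)\<close> plus the deficit;
    nonexpansiveness of \<open>T\<close> makes the first summand nonnegative.\<close>
  ultimately show ?thesis
    unfolding Ruv norm_convex_combination_squared u_def[symmetric]
    by (simp add: algebra_simps)
qed

theorem proposition2p11:
  fixes R :: "'a::{real_inner, complete_space} \<Rightarrow> 'a" and \<alpha> :: real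
  assumes "0 < \<alpha>" and "\<alpha> < 1"
    and "averaged \<alpha> R"
  shows "super_strongly_nonexpansive_with_modulus R (\<lambda>\<epsilon>. \<epsilon>\<^sup>2 * ((1 - \<alpha>) / \<alpha>))"
  unfolding super_strongly_nonexpansive_with_modulus_def
proof (intro conjI allI impI)
  fix \<epsilon> :: real
  assume "\<epsilon> > 0"
  then show "\<epsilon>\<^sup>2 * ((1 - \<alpha>) / \<alpha>) > 0"
    using assms(1,2) by simp
next
  fix \<epsilon> :: real and x y :: 'a
  assume "\<epsilon> > 0"
    and "(norm (x - y))\<^sup>2 - (norm (R x - R y))\<^sup>2 < \<epsilon>\<^sup>2 * ((1 - \<alpha>) / \<alpha>)"
  then have "(1 - \<alpha>) / \<alpha> * (norm ((x - y) - (R x - R y)))\<^sup>2 < (1 - \<alpha>) / \<alpha> * \<epsilon>\<^sup>2"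
    using averaged_norm_diff_squared[OF assms(1,3), of x y] by (simp only: mult.commute)
  \<comment> \<open>Positivity allows cancelling this factor from the strict inequality.\<close>
  moreover have "(1 - \<alpha>) / \<alpha> > 0"
    using assms(1,2) by simp
  ultimately have "(norm ((x - y) - (R x - R y)))\<^sup>2 < \<epsilon>\<^sup>2"
    by (simp only: mult_less_cancel_left_pos)
  then show "norm ((x - y) - (R x - R y)) < \<epsilon>"
    using \<open>\<epsilon> > 0\<close> by (simp add: power_less_imp_less_base)
qed

end
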